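(* Let the variables be partitioned as $\mathbf{x}=(x_1,\ldots,x_d)$, $\mathbf{y}$, $\mathbf{z}$. Let $\phi=f_1\ge0\wedge\cdots\wedge f_{r_1}\ge0\wedge g_1>0\wedge\cdots\wedge g_{s_1}>0$ with $f_i,g_j\in\mathbb{R}[\mathbf{x},\mathbf{y}]$ and $\psi=f_{r_1+1}\ge0\wedge\cdots\wedge f_r\ge0\wedge g_{s_1+1}>0\wedge\cdots\wedge g_s>0$ with $f_i,g_j\in\mathbb{R}[\mathbf{x},\mathbf{z}]$, all concave quadratic, such that $\phi\wedge\psi$ is unsatisfiable over the reals and there exist $\delta_1,\ldots,\delta_r\ge0$ with $-(\delta_1f_1+\cdots+\delta_rf_r)$ a nonzero sum of squares. Let $f\in\mathbb{R}[\mathbf{x}]$ be such that $\phi\Leftrightarrow\phi_1\vee\phi_2$ and $\psi\Leftrightarrow\psi_1\vee\psi_2$, where $\phi_1=(f>0\wedge\phi)$, $\phi_2=(f=0\wedge\phi)$, $\psi_1=(-f>0\wedge\psi)$, $\psi_2=(f=0\wedge\psi)$. If $I_{2,2}$ is an interpolant for $\phi_2$ and $\psi_2$, then $I:=(f>0)\vee(f\ge0\wedge I_{2,2})$ is an interpolant for $\phi$ and $\psi$.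
   Context: A polynomial is concave quadratic if it has the form $\mathbf{w}^TA\mathbf{w}+2\vec\alpha^T\mathbf{w}+a$ with $A$ real symmetric negative semidefinite. Given formulas $\alpha,\beta$ over the reals with $\alpha\wedge\beta$ unsatisfiable, a (reverse) interpolant is a formula $I$ with $\alpha\models I$, $I\wedge\beta$ unsatisfiable, and $I$ containing only variables common to $\alpha$ and $\beta$. *)

theory Defs
  imports Complex_Main "HOL-Library.Poly_Mapping"
begin

text \<open>
  Real multivariate polynomials: finitely supported maps from monomials (finitely supported
  exponent vectors over the variables \<open>0, 1, 2, \<dots>\<close>) to coefficients. The ring structure is the
  convolution ring of \<^theory>\<open>HOL-Library.Poly_Mapping\<close>.
\<close>

type_synonym rpoly = "(nat \<Rightarrow>\<^sub>0 nat) \<Rightarrow>\<^sub>0 real"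

definition Const :: "real \<Rightarrow> rpoly" where
  "Const c = Poly_Mapping.single 0 c"

definition Var :: "nat \<Rightarrow> rpoly" where
  "Var v = Poly_Mapping.single (Poly_Mapping.single v 1) 1"

definition vars :: "rpoly \<Rightarrow> nat set" where
  "vars p = (\<Union>m\<in>Poly_Mapping.keys p. Poly_Mapping.keys m)"

definition peval :: "(nat \<Rightarrow> real) \<Rightarrow> rpoly \<Rightarrow> real" where
  "peval e p = (\<Sum>m\<in>Poly_Mapping.keys p. Poly_Mapping.lookup p m *
      (\<Prod>v\<in>Poly_Mapping.keys m. e v ^ Poly_Mapping.lookup m v))"

text \<open>
  \<open>V\<close> is the finite set of variables that form the vector \<open>w\<close>; the matrix and the vector
  are only read at indices in \<open>V\<close>. The last clause is an identity of polynomials.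
\<close>

definition concave_quadratic :: "nat set \<Rightarrow> rpoly \<Rightarrow> bool" where
  "concave_quadratic V p \<longleftrightarrow>
    (\<exists>(A :: nat \<Rightarrow> nat \<Rightarrow> real) (\<alpha> :: nat \<Rightarrow> real) (a :: real).
      (\<forall>i\<in>V. \<forall>j\<in>V. A i j = A j i) \<and>
      (\<forall>w :: nat \<Rightarrow> real. (\<Sum>i\<in>V. \<Sum>j\<in>V. w i * A i j * w j) \<le> 0) \<and>
      p = (\<Sum>i\<in>V. \<Sum>j\<in>V. Var i * Const (A i j) * Var j)
          + 2 * (\<Sum>i\<in>V. Const (\<alpha> i) * Var i) + Const a)"

definition sum_of_squares :: "nat set \<Rightarrow> rpoly \<Rightarrow> bool" where
  "sum_of_squares V p \<longleftrightarrow>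
    (\<exists>qs :: rpoly list. (\<forall>q\<in>set qs. vars q \<subseteq> V) \<and> p = (\<Sum>q\<leftarrow>qs. q ^ 2))"

text \<open>First-order formulas over the ordered field of the reals.\<close>

datatype fm =
    Tr
  | Geq rpoly  \<comment> \<open>\<open>p \<ge> 0\<close>\<close>
  | Gtr rpoly  \<comment> \<open>\<open>p > 0\<close>\<close>
  | Eql rpoly  \<comment> \<open>\<open>p = 0\<close>\<close>
  | Neg fm
  | Conj fm fm
  | Disj fm fm
  | Ex nat fm
  | All nat fm

primrec sat :: "(nat \<Rightarrow> real) \<Rightarrow> fm \<Rightarrow> bool" where
  "sat e Tr \<longleftrightarrow> True"
| "sat e (Geq p) \<longleftrightarrow> peval e p \<ge> 0"
| "sat e (Gtr p) \<longleftrightarrow> peval e p > 0"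
| "sat e (Eql p) \<longleftrightarrow> peval e p = 0"
| "sat e (Neg \<alpha>) \<longleftrightarrow> \<not> sat e \<alpha>"
| "sat e (Conj \<alpha> \<beta>) \<longleftrightarrow> sat e \<alpha> \<and> sat e \<beta>"
| "sat e (Disj \<alpha> \<beta>) \<longleftrightarrow> sat e \<alpha> \<or> sat e \<beta>"
| "sat e (Ex v \<alpha>) \<longleftrightarrow> (\<exists>t. sat (e(v := t)) \<alpha>)"
| "sat e (All v \<alpha>) \<longleftrightarrow> (\<forall>t. sat (e(v := t)) \<alpha>)"

primrec fv :: "fm \<Rightarrow> nat set" where
  "fv Tr = {}"
| "fv (Geq p) = vars p"
| "fv (Gtr p) = vars p"
| "fv (Eql p) = vars p"
| "fv (Neg \<alpha>) = fv \<alpha>"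
| "fv (Conj \<alpha> \<beta>) = fv \<alpha> \<union> fv \<beta>"
| "fv (Disj \<alpha> \<beta>) = fv \<alpha> \<union> fv \<beta>"
| "fv (Ex v \<alpha>) = fv \<alpha> - {v}"
| "fv (All v \<alpha>) = fv \<alpha> - {v}"

definition Conjs :: "fm list \<Rightarrow> fm" where
  "Conjs \<alpha>s = foldr Conj \<alpha>s Tr"

definition entails :: "fm \<Rightarrow> fm \<Rightarrow> bool" where
  "entails \<alpha> \<beta> \<longleftrightarrow> (\<forall>e. sat e \<alpha> \<longrightarrow> sat e \<beta>)"

definition equivalent :: "fm \<Rightarrow> fm \<Rightarrow> bool" where
  "equivalent \<alpha> \<beta> \<longleftrightarrow> (\<forall>e. sat e \<alpha> \<longleftrightarrow> sat e \<beta>)"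

definition unsatisfiable :: "fm \<Rightarrow> bool" where
  "unsatisfiable \<alpha> \<longleftrightarrow> (\<nexists>e. sat e \<alpha>)"

text \<open>
  Reverse interpolants. As for the polynomial rings \<open>\<real>[x,y]\<close> and \<open>\<real>[x,z]\<close>, the variables of
  \<open>\<alpha>\<close> and \<open>\<beta>\<close> are the declared sets \<open>A\<close> and \<open>B\<close>, which may be larger than \<open>fv \<alpha>\<close> and \<open>fv \<beta>\<close>;
  the common variables are those in \<open>A \<inter> B\<close>. Taking \<open>A = fv \<alpha>\<close> and \<open>B = fv \<beta>\<close> gives the notion
  based on actual occurrence.
\<close>

definition interpolant :: "nat set \<Rightarrow> nat set \<Rightarrow> fm \<Rightarrow> fm \<Rightarrow> fm \<Rightarrow> bool" where
  "interpolant A B \<alpha> \<beta> I \<longleftrightarrow>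
    fv \<alpha> \<subseteq> A \<and> fv \<beta> \<subseteq> B \<and> unsatisfiable (Conj \<alpha> \<beta>) \<and>
    entails \<alpha> I \<and> unsatisfiable (Conj I \<beta>) \<and> fv I \<subseteq> A \<inter> B"

end

theory Submission
  imports Defs
begin

text \<open>The polynomial \<open>h\<close> weakly separates the two solution sets: the splitting of
  \<phi> forces \<open>h\<close> \<ge> 0 on its models, and that of \<psi> forces \<open>h\<close>
  \<le> 0 on its models. Only points on the zero set of \<open>h\<close> remain undecided, and there
  the models of \<phi> and \<psi> are exactly those of \<open>\<phi>2\<close> and
  \<open>\<psi>2\<close>, which \<open>I22\<close> tells apart.
  \<open>interpolant_separation\<close> carries this argument; the theorem is its instance for the
  variable sets \<open>X \<union> Y\<close> and \<open>X \<union> Z\<close>.\<close>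

lemma peval_uminus: "peval e (- p) = - peval e p"
  by (simp add: peval_def keys_def sum_negf)

text \<open>The sign of \<open>h\<close> decides the combined formula: it is true where
  \<open>h\<close> > 0, false where \<open>h\<close> < 0, and agrees with \<open>I\<close> where
  \<open>h\<close> = 0.\<close>

lemma interpolant_separation:
  assumes unsat: "unsatisfiable (Conj \<phi> \<psi>)"
    and h: "vars h \<subseteq> A \<inter> B"
    and \<phi>: "equivalent \<phi> (Disj (Conj (Gtr h) \<phi>) (Conj (Eql h) \<phi>))"
    and \<psi>: "equivalent \<psi> (Disj (Conj (Gtr (- h)) \<psi>) (Conj (Eql h) \<psi>))"
    and I: "interpolant A B (Conj (Eql h) \<phi>) (Conj (Eql h) \<psi>) I"
  shows "interpolant A B \<phi> \<psi> (Disj (Gtr h) (Conj (Geq h) I))"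
proof -
  have "sat e (Disj (Gtr h) (Conj (Geq h) I))" if "sat e \<phi>" for e
  proof -
    have "peval e h > 0 \<or> peval e h = 0"
      using \<phi> that by (auto simp: equivalent_def)
    moreover have "sat e I" if "peval e h = 0"
      using I that \<open>sat e \<phi>\<close> by (simp add: interpolant_def entails_def)
    ultimately show ?thesis by auto
  qed
  moreover have "\<not> sat e (Disj (Gtr h) (Conj (Geq h) I))" if "sat e \<psi>" for e
  proof -
    have "peval e h < 0 \<or> peval e h = 0"
      using \<psi> that by (auto simp: equivalent_def peval_uminus)
    \<comment> \<open>On the zero set, \<open>e\<close> is a model of
      \<open>Conj (Eql h) \<psi>\<close>, which is inconsistent with \<open>I\<close>. Where
      \<open>h\<close> < 0, both disjuncts fail by sign alone.\<close>
    moreover have "\<not> sat e I" if "peval e h = 0"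
      using I that \<open>sat e \<psi>\<close> by (auto simp: interpolant_def unsatisfiable_def)
    ultimately show ?thesis by auto
  qed
  ultimately show ?thesis
    \<comment> \<open>The variable conditions remain. Those on \<phi>, \<psi> and \<open>I\<close>
      are inherited from \<open>I\<close>'s being an interpolant, since conjoining
      \<open>Eql h\<close> only adds free variables; the atoms in \<open>h\<close> are covered by
      assumption \<open>h\<close>.\<close>
    using unsat h I by (simp add: interpolant_def entails_def unsatisfiable_def) blast
qed

theorem theorem5:
  fixes X Y Z :: "nat set"
    and r1 r s1 s :: nat
    and f g :: "nat \<Rightarrow> rpoly"
    and h :: rpoly
    and \<phi> \<psi> \<phi>1 \<phi>2 \<psi>1 \<psi>2 I22 :: fm
  assumes "finite X" and "finite Y" and "finite Z"
    and "X \<inter> Y = {}" and "X \<inter> Z = {}" and "Y \<inter> Z = {}"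
    and "r1 \<le> r" and "s1 \<le> s"
    and "\<forall>i\<in>{1..r1}. vars (f i) \<subseteq> X \<union> Y \<and> concave_quadratic (X \<union> Y) (f i)"
    and "\<forall>i\<in>{r1+1..r}. vars (f i) \<subseteq> X \<union> Z \<and> concave_quadratic (X \<union> Z) (f i)"
    and "\<forall>j\<in>{1..s1}. vars (g j) \<subseteq> X \<union> Y \<and> concave_quadratic (X \<union> Y) (g j)"
    and "\<forall>j\<in>{s1+1..s}. vars (g j) \<subseteq> X \<union> Z \<and> concave_quadratic (X \<union> Z) (g j)"
    and "\<phi> = Conj (Conjs (map (\<lambda>i. Geq (f i)) [1..<r1+1]))
                   (Conjs (map (\<lambda>j. Gtr (g j)) [1..<s1+1]))"
    and "\<psi> = Conj (Conjs (map (\<lambda>i. Geq (f i)) [r1+1..<r+1]))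
                   (Conjs (map (\<lambda>j. Gtr (g j)) [s1+1..<s+1]))"
    and "unsatisfiable (Conj \<phi> \<psi>)"
    and "\<exists>\<delta> :: nat \<Rightarrow> real. (\<forall>i\<in>{1..r}. \<delta> i \<ge> 0) \<and>
           - (\<Sum>i=1..r. Const (\<delta> i) * f i) \<noteq> 0 \<and>
           sum_of_squares (X \<union> Y \<union> Z) (- (\<Sum>i=1..r. Const (\<delta> i) * f i))"
    and "vars h \<subseteq> X"
    and "\<phi>1 = Conj (Gtr h) \<phi>" and "\<phi>2 = Conj (Eql h) \<phi>"
    and "\<psi>1 = Conj (Gtr (- h)) \<psi>" and "\<psi>2 = Conj (Eql h) \<psi>"
    and "equivalent \<phi> (Disj \<phi>1 \<phi>2)" and "equivalent \<psi> (Disj \<psi>1 \<psi>2)"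
    and "interpolant (X \<union> Y) (X \<union> Z) \<phi>2 \<psi>2 I22"
  shows "interpolant (X \<union> Y) (X \<union> Z) \<phi> \<psi> (Disj (Gtr h) (Conj (Geq h) I22))"
proof -
  have "vars h \<subseteq> (X \<union> Y) \<inter> (X \<union> Z)"
    using \<open>vars h \<subseteq> X\<close> by blast
  then show ?thesis
    \<comment> \<open>Unfolding the four names \<open>\<phi>1\<close>, \<open>\<phi>2\<close>,
      \<open>\<psi>1\<close>, \<open>\<psi>2\<close> turns both equivalences and the interpolant
      \<open>I22\<close> into the premises of the lemma.\<close>
    using assms(15,22-24) unfolding assms(18-21) by (intro interpolant_separation)
qed

end
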